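(* Let $\epsilon>0$ and let $Z=f(x,\Xi)$ with $x\in\mathcal{X}$. Let $\bar\mu$ be the positive solution of $\bar\mu-\log(2+\bar\mu)=1$. Assume $\mu,\tau\in\mathbb{R}_+$ satisfy $\mu\ge\bar\mu$ and $\tau\ge\frac12\epsilon^{-1}(\mu+1)$. Then $$d_{\mu,\tau}:=\mathbb{E}\left[\psi_{ss}^{\mu,\tau}(Z)\right]-\epsilon^{-1}\,\mathbb{E}\left[[Z+\epsilon]_+-[Z]_+\right]\le\frac{2}{\mu}.$$
   Context: $(\Omega,\mathcal{F},\mathbb{P})$ is a probability space and $\Xi:\Omega\to\mathbb{R}^d$ is a random vector. $\mathcal{X}=\{x\in\mathbb{R}^n : g(x)\ge 0\}$ is nonempty and compact, with $g:\mathbb{R}^n\to\mathbb{R}^m$ twice differentiable. The scalar function $f(x,\xi)$, $x\in\mathbb{R}^n$, $\xi\in\mathbb{R}^d$, is real-valued and twice continuously differentiable. Write $[a]_+:=\max\{a,0\}$ and $$\psi_{ss}^{\mu,\tau}(z):=\left[2\,\frac{1+\mu}{\mu+e^{-\tau z}}-1\right]_+,\qquad z\in\mathbb{R}.$$ The parameter $\epsilon$ is that of the difference-of-convex (DC) approximation $\epsilon^{-1}\mathbb{E}[[f(x,\Xi)+\epsilon]_+-[f(x,\Xi)]_+]\le\alpha$ of the chance constraint $\mathbb{P}(f(x,\Xi)>0)\le\alpha$. *)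

theory Defs
  imports "HOL-Probability.Probability"
begin

text \<open>Twice (continuously) differentiable on the whole space, in the Frechet sense: the
  derivative is a map into the normed space of bounded linear functions and is itself
  (continuously) differentiable.\<close>

definition twice_differentiable ::
    "('a::real_normed_vector \<Rightarrow> 'b::real_normed_vector) \<Rightarrow> bool" where
  "twice_differentiable h \<longleftrightarrow>
    (\<exists>h' :: 'a \<Rightarrow> 'a \<Rightarrow>\<^sub>L 'b.
      (\<forall>x. (h has_derivative blinfun_apply (h' x)) (at x)) \<and>
      (\<forall>x. h' differentiable (at x)))"

definition twice_continuously_differentiable ::
    "('a::real_normed_vector \<Rightarrow> 'b::real_normed_vector) \<Rightarrow> bool" where
  "twice_continuously_differentiable h \<longleftrightarrow>
    (\<exists>(h' :: 'a \<Rightarrow> 'a \<Rightarrow>\<^sub>L 'b) (h'' :: 'a \<Rightarrow> 'a \<Rightarrow>\<^sub>L 'a \<Rightarrow>\<^sub>L 'b).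
      (\<forall>x. (h has_derivative blinfun_apply (h' x)) (at x)) \<and>
      (\<forall>x. (h' has_derivative blinfun_apply (h'' x)) (at x)) \<and>
      continuous_on UNIV h'')"

definition feasible_set :: "(real ^ 'n \<Rightarrow> real ^ 'm) \<Rightarrow> (real ^ 'n) set" where
  "feasible_set g = {x. \<forall>i. g x $ i \<ge> 0}"

definition pos_part :: "real \<Rightarrow> real" where
  "pos_part a = max a 0"

definition psi_ss :: "real \<Rightarrow> real \<Rightarrow> real \<Rightarrow> real" where
  "psi_ss \<mu> \<tau> z = pos_part (2 * ((1 + \<mu>) / (\<mu> + exp (- \<tau> * z))) - 1)"

end

theory Submission imports Defs begin

text \<open>The inequality holds pointwise in \<open>z = Z \<omega>\<close> and is then integrated against a
  probability measure, under which the constant \<open>2 / \<mu>\<close> keeps its value.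

  Put \<open>t = min 1 (max 0 (- z / \<epsilon>))\<close>. The DC approximation of the step function is
  \<open>1 - t\<close>, so the sigmoid must be at most \<open>1 + 2 / \<mu> - t\<close>, that is, it must
  have fallen by at least \<open>t\<close> from its limit \<open>1 + 2 / \<mu>\<close> at infinity. Truncating the
  sigmoid at zero does no harm because \<open>t \<le> 1\<close>. For \<open>z \<ge> 0\<close> no fall is required,
  since \<open>t = 0\<close>. For \<open>z < 0\<close> the lower bound on \<open>\<tau>\<close>
  makes the exponential in the sigmoid at least \<open>exp s\<close> with
  \<open>s = (\<mu> + 1) / 2 * t\<close>. Clearing denominators, the claim becomes
  \<open>(\<mu> + 1)\<^sup>2 * exp s \<ge> s * \<mu> * (\<mu> + exp s)\<close>, which follows from \<open>exp s \<ge> 2 * s\<close>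
  (for the term \<open>s * \<mu>\<^sup>2\<close>) and \<open>s \<le> (\<mu> + 1) / 2\<close> (for the term \<open>s * \<mu> * exp s\<close>).
  These are \<open>sigmoid_drop\<close> and \<open>psi_ss_minus_dc_le\<close>. Both expectations exist because
  \<open>f\<close> is continuous and both integrands are bounded.\<close>

lemma sigmoid_le_sup:
  fixes \<mu> E :: real
  assumes "0 < \<mu>" "0 < E"
  shows "2 * ((1 + \<mu>) / (\<mu> + E)) \<le> 2 * (1 + \<mu>) / \<mu>"
proof -
  have "(1 + \<mu>) / (\<mu> + E) \<le> (1 + \<mu>) / \<mu>"
    using assms by (intro divide_left_mono mult_pos_pos) auto
  then show ?thesis by linarith
qed

lemma exp_ge_twice:
  fixes s :: real
  assumes "0 \<le> s"
  shows "2 * s \<le> exp s"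
proof -
  have "2 * s \<le> (1 + s / 2)\<^sup>2"
    using zero_le_power2[of "1 - s / 2"] by (simp add: power2_eq_square algebra_simps)
  also have "\<dots> \<le> (exp (s / 2))\<^sup>2"
    using assms by (intro power_mono exp_ge_add_one_self) auto
  also have "\<dots> = exp s"
    by (simp flip: exp_double)
  finally show ?thesis .
qed

text \<open>Since \<open>2 * (1 + \<mu>) / \<mu>\<close> is the supremum of the sigmoid term over \<open>E > 0\<close>, the
  statement quantifies how far that term has dropped from its supremum when the exponential
  has size \<open>E\<close>.\<close>

lemma sigmoid_drop:
  fixes \<mu> t E :: real
  assumes \<mu>: "0 < \<mu>" and t: "0 \<le> t" "t \<le> 1" and E: "exp ((\<mu> + 1) / 2 * t) \<le> E"
  shows "2 * ((1 + \<mu>) / (\<mu> + E)) \<le> 2 * (1 + \<mu>) / \<mu> - t"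
proof -
  define s where "s = (\<mu> + 1) / 2 * t"
  define e where "e = exp s"
  have e: "0 < e" "2 * s \<le> e"
    using \<mu> t exp_ge_twice[of s] by (auto simp: e_def s_def)
  have s: "0 \<le> s" "s \<le> (\<mu> + 1) / 2"
    using \<mu> t mult_left_mono[of t 1 "(\<mu> + 1) / 2"] by (auto simp: s_def)
  have "s * \<mu>\<^sup>2 \<le> e / 2 * \<mu>\<^sup>2" "s * (\<mu> * e) \<le> (\<mu> + 1) / 2 * (\<mu> * e)"
    using e s \<mu> by (auto intro!: mult_right_mono)
  moreover have "e / 2 * \<mu>\<^sup>2 + (\<mu> + 1) / 2 * (\<mu> * e) \<le> (\<mu> + 1)\<^sup>2 * e"
  proof -
    have "(\<mu> + 1)\<^sup>2 * e - (e / 2 * \<mu>\<^sup>2 + (\<mu> + 1) / 2 * (\<mu> * e)) = e * (3 / 2 * \<mu> + 1)"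
      by (simp add: power2_eq_square field_simps)
    moreover have "\<dots> \<ge> 0" using e \<mu> by simp
    ultimately show ?thesis by linarith
  qed
  moreover have "s * (\<mu> * (\<mu> + e)) = s * \<mu>\<^sup>2 + s * (\<mu> * e)"
    by (simp add: power2_eq_square algebra_simps)
  ultimately have "s * (\<mu> * (\<mu> + e)) \<le> (\<mu> + 1)\<^sup>2 * e"
    by linarith
  then have "(\<mu> + 1) * (t * (\<mu> * (\<mu> + e))) \<le> (\<mu> + 1) * (2 * (1 + \<mu>) * e)"
    by (simp add: s_def power2_eq_square algebra_simps)
  then have "t * (\<mu> * (\<mu> + e)) \<le> 2 * (1 + \<mu>) * e"
    using \<mu> by (simp add: mult_le_cancel_left)
  then have "t \<le> 2 * (1 + \<mu>) * e / (\<mu> * (\<mu> + e))"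
    using \<mu> e by (simp add: pos_le_divide_eq)
  also have "\<dots> = 2 * (1 + \<mu>) / \<mu> - 2 * ((1 + \<mu>) / (\<mu> + e))"
    using \<mu> e by (simp add: divide_simps) (simp add: algebra_simps)
  finally have "2 * ((1 + \<mu>) / (\<mu> + e)) \<le> 2 * (1 + \<mu>) / \<mu> - t" by linarith
  moreover have "e \<le> E" using E by (simp add: e_def s_def)
  then have "(1 + \<mu>) / (\<mu> + E) \<le> (1 + \<mu>) / (\<mu> + e)"
    using \<mu> e(1) by (intro divide_left_mono mult_pos_pos) auto
  ultimately show ?thesis by linarith
qed

lemma dc_eq_ramp:
  assumes "0 < \<epsilon>"
  shows "inverse \<epsilon> * (pos_part (z + \<epsilon>) - pos_part z) = 1 - min 1 (max 0 (- z / \<epsilon>))"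
proof -
  consider "z \<ge> 0" | "z \<le> - \<epsilon>" | "- \<epsilon> < z" "z < 0" by linarith
  then show ?thesis
    using assms by cases (auto simp: pos_part_def field_simps min_def max_def)
qed

text \<open>For \<open>z \<ge> 0\<close> the DC term equals 1 and the bound is just the supremum of the sigmoid.
  For \<open>z < 0\<close> the condition on \<open>\<tau>\<close> says that \<open>- \<tau> * z\<close> is at least
  \<open>(\<mu> + 1) / 2 * (- z / \<epsilon>)\<close>, so the drop of the sigmoid is at least that of the
  ramp.\<close>

lemma psi_ss_minus_dc_le:
  assumes \<mu>: "0 < \<mu>" and \<epsilon>: "0 < \<epsilon>" and \<tau>: "1 / 2 * inverse \<epsilon> * (\<mu> + 1) \<le> \<tau>"
  shows "psi_ss \<mu> \<tau> z - inverse \<epsilon> * (pos_part (z + \<epsilon>) - pos_part z) \<le> 2 / \<mu>"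
proof -
  define t where "t = min 1 (max 0 (- z / \<epsilon>))"
  have t: "0 \<le> t" "t \<le> 1" by (auto simp: t_def)
  have sup: "2 * (1 + \<mu>) / \<mu> = 2 + 2 / \<mu>" using \<mu> by (simp add: field_simps)
  have "2 * ((1 + \<mu>) / (\<mu> + exp (- \<tau> * z))) \<le> 2 * (1 + \<mu>) / \<mu> - t"
  proof (cases "z \<ge> 0")
    case True
    then have "t = 0" using \<epsilon> by (simp add: t_def divide_nonneg_pos)
    then show ?thesis using sigmoid_le_sup[OF \<mu>, of "exp (- \<tau> * z)"] by simp
  next
    case False
    then have "0 < - z / \<epsilon>" using \<epsilon> by (simp add: divide_neg_pos)
    then have "t \<le> - z / \<epsilon>" by (simp add: t_def)
    then have "(\<mu> + 1) / 2 * t \<le> (\<mu> + 1) / 2 * (- z / \<epsilon>)"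
      using \<mu> by (intro mult_left_mono) auto
    also have "\<dots> = 1 / 2 * inverse \<epsilon> * (\<mu> + 1) * (- z)"
      by (simp add: inverse_eq_divide)
    also have "\<dots> \<le> \<tau> * (- z)"
      using \<tau> False by (intro mult_right_mono) auto
    finally show ?thesis
      using \<mu> t by (intro sigmoid_drop) auto
  qed
  moreover have "0 < 2 / \<mu>" using \<mu> by simp
  ultimately have "psi_ss \<mu> \<tau> z \<le> 1 + 2 / \<mu> - t"
    using t unfolding psi_ss_def pos_part_def sup by linarith
  then show ?thesis
    unfolding dc_eq_ramp[OF \<epsilon>] by (simp add: t_def)
qed

lemma psi_ss_bounds:
  assumes "0 < \<mu>"
  shows "0 \<le> psi_ss \<mu> \<tau> z" "psi_ss \<mu> \<tau> z \<le> 2 * (1 + \<mu>) / \<mu>"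
proof -
  show "0 \<le> psi_ss \<mu> \<tau> z" by (simp add: psi_ss_def pos_part_def)
  have "0 \<le> 2 * (1 + \<mu>) / \<mu>" using assms by simp
  then show "psi_ss \<mu> \<tau> z \<le> 2 * (1 + \<mu>) / \<mu>"
    using sigmoid_le_sup[OF assms, of "exp (- \<tau> * z)"]
    unfolding psi_ss_def pos_part_def by simp
qed

lemma twice_continuously_differentiable_imp_continuous_on:
  assumes "twice_continuously_differentiable h"
  shows "continuous_on UNIV h"
  using assms has_derivative_continuous
  unfolding twice_continuously_differentiable_def
  by (blast intro: continuous_at_imp_continuous_on)

lemma pos_part_measurable [measurable]: "pos_part \<in> borel_measurable borel"
  unfolding pos_part_def by measurable

lemma psi_ss_measurable [measurable]: "psi_ss \<mu> \<tau> \<in> borel_measurable borel"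
  unfolding psi_ss_def by measurable

theorem proposition3:
  fixes M :: "'w measure"
    and \<Xi> :: "'w \<Rightarrow> real ^ 'd"
    and g :: "real ^ 'n \<Rightarrow> real ^ 'm"
    and f :: "real ^ 'n \<Rightarrow> real ^ 'd \<Rightarrow> real"
    and x :: "real ^ 'n"
    and Z :: "'w \<Rightarrow> real"
    and \<epsilon> \<mu>bar \<mu> \<tau> :: real
  assumes "prob_space M"
    and "\<Xi> \<in> borel_measurable M"
    and "twice_differentiable g"
    and "feasible_set g \<noteq> {}"
    and "compact (feasible_set g)"
    and "twice_continuously_differentiable (\<lambda>(y, \<xi>). f y \<xi>)"
    and "\<epsilon> > 0"
    and "x \<in> feasible_set g"
    and "Z = (\<lambda>\<omega>. f x (\<Xi> \<omega>))"
    and "\<mu>bar > 0"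
    and "\<mu>bar - ln (2 + \<mu>bar) = 1"
    and "\<mu> \<ge> 0"
    and "\<tau> \<ge> 0"
    and "\<mu> \<ge> \<mu>bar"
    and "\<tau> \<ge> 1 / 2 * inverse \<epsilon> * (\<mu> + 1)"
  shows "(\<integral>\<omega>. psi_ss \<mu> \<tau> (Z \<omega>) \<partial>M)
      - inverse \<epsilon> * (\<integral>\<omega>. (pos_part (Z \<omega> + \<epsilon>) - pos_part (Z \<omega>)) \<partial>M) \<le> 2 / \<mu>"
proof -
  interpret prob_space M by fact
  have \<epsilon>: "0 < \<epsilon>" and \<mu>: "0 < \<mu>" using assms by auto
  have "continuous_on UNIV ((\<lambda>(y, \<xi>). f y \<xi>) \<circ> Pair x)"
    using twice_continuously_differentiable_imp_continuous_on[OF assms(6)]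
    by (intro continuous_on_compose continuous_intros) (auto intro: continuous_on_subset)
  then have "f x \<in> borel_measurable borel"
    by (intro borel_measurable_continuous_onI) (simp add: comp_def)
  then have [measurable]: "Z \<in> borel_measurable M"
    using assms(2,9) by (auto intro: measurable_compose)
  define D where "D \<omega> = inverse \<epsilon> * (pos_part (Z \<omega> + \<epsilon>) - pos_part (Z \<omega>))" for \<omega>
  have int_psi: "integrable M (\<lambda>\<omega>. psi_ss \<mu> \<tau> (Z \<omega>))"
    using psi_ss_bounds[OF \<mu>]
    by (intro integrable_const_bound[where B = "2 * (1 + \<mu>) / \<mu>"]) auto
  have D_meas: "D \<in> borel_measurable M" unfolding D_def by measurable
  have int_D: "integrable M D"
    by (rule integrable_const_bound[where B = 1, OF _ D_meas])
       (auto simp: D_def dc_eq_ramp[OF \<epsilon>])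
  have "(\<integral>\<omega>. psi_ss \<mu> \<tau> (Z \<omega>) \<partial>M)
      - inverse \<epsilon> * (\<integral>\<omega>. (pos_part (Z \<omega> + \<epsilon>) - pos_part (Z \<omega>)) \<partial>M)
      = (\<integral>\<omega>. psi_ss \<mu> \<tau> (Z \<omega>) \<partial>M) - (\<integral>\<omega>. D \<omega> \<partial>M)"
    by (simp add: D_def)
  also have "\<dots> = (\<integral>\<omega>. psi_ss \<mu> \<tau> (Z \<omega>) - D \<omega> \<partial>M)"
    using int_psi int_D by simp
  also have "\<dots> \<le> (\<integral>\<omega>. 2 / \<mu> \<partial>M)"
  proof (rule integral_mono)
    show "psi_ss \<mu> \<tau> (Z \<omega>) - D \<omega> \<le> 2 / \<mu>" for \<omega>
      using psi_ss_minus_dc_le[OF \<mu> \<epsilon> assms(15)] by (simp add: D_def)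
  qed (use int_psi int_D in auto)
  also have "\<dots> = 2 / \<mu>" by (simp add: prob_space)
  finally show ?thesis .
qed

end
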